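(* Let $H$ be a separable complex Hilbert space, let $T \in B(H)$ be a quasidiagonal operator and let $P_1 \leq P_2 \leq \cdots$ be any filtration of $H$ such that $\|[P_n,T]\| \to 0$. Then the following statements hold for every $n$: (1) For every $\varepsilon > 0$, $\sigma^{(\varepsilon)}(P_nTP_n) \subset \sigma^{(\varepsilon + \|[P_n,T]\|)}(T)$. (2) $\sigma_2(P_nTP_n) \subset^{\delta_n} \sigma_2(T)$, where $\delta_n = \sqrt{2\|T\|\,\|[P_n,T]\|}$.
   Context: A filtration of $H$ is a sequence of finite rank orthogonal projections $P_n = P_n^* = P_n^2$ with $P_nH \subset P_{n+1}H$ for all $n$ and $\|P_n v - v\| \to 0$ for all $v \in H$. $[P,T] = PT - TP$. An operator $T \in B(H)$ is quasidiagonal if there exist finite rank orthogonal projections $Q_n$ with $\|Q_n v - v\| \to 0$ for all $v \in H$ and $\|[T,Q_n]\| \to 0$. $P_nTP_n$ is regarded as an operator on the finite dimensional space $P_nH$ (i.e. as a matrix), and its spectral quantities are computed there. For $\varepsilon > 0$ the $\varepsilon$-pseudospectrum of an operator $X$ is $\sigma^{(\varepsilon)}(X) = \{\lambda \in \mathbb{C} : \|(\lambda - X)^{-1}\| \geq 1/\varepsilon\}$, with the convention that $\|Y^{-1}\| = \infty$ if $Y$ is not invertible. The set of singular values of $X$ is $\sigma_2(X) = \{\lambda \geq 0 : \lambda^2 \in \sigma(X^*X)\}$. For $\Sigma,\Lambda \subset \mathbb{C}$ and $\delta \geq 0$, $\Sigma \subset^{\delta} \Lambda$ means that for every $\sigma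 \in \Sigma$ there is $\lambda \in \Lambda$ with $|\sigma - \lambda| \leq \delta$. *)

theory Defs
  imports "HOL-Analysis.Analysis"
begin

section \<open>Complex Hilbert spaces\<close>

class complex_vector = real_vector +
  fixes scaleC :: "complex \<Rightarrow> 'a \<Rightarrow> 'a"  (infixr \<open>*\<^sub>C\<close> 75)
  assumes scaleC_add_right: "a *\<^sub>C (x + y) = a *\<^sub>C x + a *\<^sub>C y"
    and scaleC_add_left: "(a + b) *\<^sub>C x = a *\<^sub>C x + b *\<^sub>C x"
    and scaleC_scaleC: "a *\<^sub>C b *\<^sub>C x = (a * b) *\<^sub>C x"
    and scaleC_one: "1 *\<^sub>C x = x"
    and scaleR_scaleC: "scaleR r x = complex_of_real r *\<^sub>C x"

global_interpretation complex_vector: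
  vector_space "scaleC :: complex \<Rightarrow> 'a \<Rightarrow> 'a::complex_vector"
  by unfold_locales
    (simp_all add: scaleC_add_right scaleC_add_left scaleC_scaleC scaleC_one)

text \<open>The inner product is antilinear in the first and linear in the second argument.
  The real structure (metric, topology, completeness, \<open>onorm\<close>) is inherited from
  \<open>real_normed_vector\<close>; the last axiom says that its norm is the one of the inner product.\<close>

class complex_inner = complex_vector + real_normed_vector +
  fixes cinner :: "'a \<Rightarrow> 'a \<Rightarrow> complex"
  assumes cinner_commute: "cinner x y = cnj (cinner y x)"
    and cinner_add_right: "cinner x (y + z) = cinner x y + cinner x z"
    and cinner_scaleC_right: "cinner x (a *\<^sub>C y) = a * cinner x y"
    and cinner_self: "cinner x x = complex_of_real ((norm x)\<^sup>2)"

class chilbert_space = complex_inner + complete_space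

definition separable_hilbert :: "'h::chilbert_space itself \<Rightarrow> bool" where
  "separable_hilbert _ \<longleftrightarrow> (\<exists>D :: 'h set. countable D \<and> closure D = UNIV)"


section \<open>Bounded operators on a closed subspace\<close>

text \<open>The compressions \<open>P\<^sub>n T P\<^sub>n\<close> are operators on the subspace \<open>P\<^sub>n H\<close>, not on \<open>H\<close>.
  So the notions below carry the underlying closed subspace \<open>S\<close> as a parameter and depend
  only on the restriction of \<open>X\<close> to \<open>S\<close>; for operators on all of \<open>H\<close>, \<open>S\<close> is \<open>UNIV\<close>.\<close>

definition bounded_op_on :: "'h::chilbert_space set \<Rightarrow> ('h \<Rightarrow> 'h) \<Rightarrow> bool" where
  "bounded_op_on S X \<longleftrightarrow>
     X ` S \<subseteq> S \<and>
     (\<forall>x\<in>S. \<forall>y\<in>S. X (x + y) = X x + X y) \<and>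
     (\<forall>c. \<forall>x\<in>S. X (c *\<^sub>C x) = c *\<^sub>C X x) \<and>
     (\<exists>K. \<forall>x\<in>S. norm (X x) \<le> K * norm x)"

text \<open>\<open>onorm_on UNIV\<close> is the library's \<open>onorm\<close>.\<close>

definition onorm_on :: "'h::chilbert_space set \<Rightarrow> ('h \<Rightarrow> 'h) \<Rightarrow> real" where
  "onorm_on S X = (SUP x\<in>S. norm (X x) / norm x)"

definition adjoint_on :: "'h::chilbert_space set \<Rightarrow> ('h \<Rightarrow> 'h) \<Rightarrow> 'h \<Rightarrow> 'h" where
  "adjoint_on S X y = (THE z. z \<in> S \<and> (\<forall>x\<in>S. cinner (X x) y = cinner x z))"

definition inverse_op_on :: "'h::chilbert_space set \<Rightarrow> ('h \<Rightarrow> 'h) \<Rightarrow> ('h \<Rightarrow> 'h) \<Rightarrow> bool" where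
  "inverse_op_on S X Y \<longleftrightarrow> bounded_op_on S Y \<and> (\<forall>x\<in>S. Y (X x) = x \<and> X (Y x) = x)"

definition invertible_on :: "'h::chilbert_space set \<Rightarrow> ('h \<Rightarrow> 'h) \<Rightarrow> bool" where
  "invertible_on S X \<longleftrightarrow> (\<exists>Y. inverse_op_on S X Y)"

text \<open>Any two inverses agree on \<open>S\<close>, so the choice does not affect the value.\<close>

definition inverse_norm_on :: "'h::chilbert_space set \<Rightarrow> ('h \<Rightarrow> 'h) \<Rightarrow> ereal" where
  "inverse_norm_on S X =
     (if invertible_on S X then ereal (onorm_on S (SOME Y. inverse_op_on S X Y)) else \<infinity>)"

definition spectrum_on :: "'h::chilbert_space set \<Rightarrow> ('h \<Rightarrow> 'h) \<Rightarrow> complex set" where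
  "spectrum_on S X = {z. \<not> invertible_on S (\<lambda>x. z *\<^sub>C x - X x)}"

definition pseudospectrum_on ::
    "'h::chilbert_space set \<Rightarrow> real \<Rightarrow> ('h \<Rightarrow> 'h) \<Rightarrow> complex set" where
  "pseudospectrum_on S \<epsilon> X =
     {z. inverse_norm_on S (\<lambda>x. z *\<^sub>C x - X x) \<ge> ereal (1 / \<epsilon>)}"

definition singular_values_on :: "'h::chilbert_space set \<Rightarrow> ('h \<Rightarrow> 'h) \<Rightarrow> complex set" where
  "singular_values_on S X =
     {complex_of_real s |s. s \<ge> 0 \<and> (complex_of_real s)\<^sup>2 \<in> spectrum_on S (adjoint_on S X \<circ> X)}"

definition subset_upto :: "real \<Rightarrow> complex set \<Rightarrow> complex set \<Rightarrow> bool" where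
  "subset_upto \<delta> \<Sigma> \<Lambda> \<longleftrightarrow> (\<forall>\<sigma>\<in>\<Sigma>. \<exists>\<tau>\<in>\<Lambda>. cmod (\<sigma> - \<tau>) \<le> \<delta>)"


section \<open>Filtrations and quasidiagonal operators\<close>

definition finite_rank_projection :: "('h::chilbert_space \<Rightarrow> 'h) \<Rightarrow> bool" where
  "finite_rank_projection P \<longleftrightarrow>
     bounded_op_on UNIV P \<and> adjoint_on UNIV P = P \<and> P \<circ> P = P \<and>
     (\<exists>B. finite B \<and> range P \<subseteq> complex_vector.span B)"

definition commutator :: "('h::chilbert_space \<Rightarrow> 'h) \<Rightarrow> ('h \<Rightarrow> 'h) \<Rightarrow> 'h \<Rightarrow> 'h" where
  "commutator A B = (\<lambda>x. A (B x) - B (A x))"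

definition filtration :: "(nat \<Rightarrow> 'h::chilbert_space \<Rightarrow> 'h) \<Rightarrow> bool" where
  "filtration P \<longleftrightarrow>
     (\<forall>n. finite_rank_projection (P n)) \<and>
     (\<forall>n. range (P n) \<subseteq> range (P (Suc n))) \<and>
     (\<forall>v. (\<lambda>n. norm (P n v - v)) \<longlonglongrightarrow> 0)"

definition quasidiagonal :: "('h::chilbert_space \<Rightarrow> 'h) \<Rightarrow> bool" where
  "quasidiagonal T \<longleftrightarrow>
     (\<exists>Q :: nat \<Rightarrow> 'h \<Rightarrow> 'h.
        (\<forall>n. finite_rank_projection (Q n)) \<and>
        (\<forall>v. (\<lambda>n. norm (Q n v - v)) \<longlonglongrightarrow> 0) \<and>
        (\<lambda>n. onorm (commutator T (Q n))) \<longlonglongrightarrow> 0)"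

end

theory Submission
  imports Defs
begin

text \<open>On \<open>P H\<close> the operators \<open>T\<close> and \<open>P T P\<close> differ by \<open>[P, T]\<close>, so an approximate
  eigenvector of \<open>P T P\<close> is one of \<open>T\<close>, with the error increased by at most \<open>\<parallel>[P, T]\<parallel>\<close>; approximate
  eigenvectors exist at every point of a pseudospectrum because \<open>P H\<close> is finite dimensional.
  For singular values, \<open>P T\<^sup>* P T P\<close> and \<open>T\<^sup>* T\<close> differ on \<open>P H\<close> by
  \<open>[P, T\<^sup>*] P T + T\<^sup>* [P, T]\<close>, of norm at most \<open>2 \<parallel>T\<parallel> \<parallel>[P, T]\<parallel>\<close>. Since \<open>T\<^sup>* T\<close> is self-adjoint, its
  spectrum meets the interval of this radius around \<open>s\<^sup>2\<close> in some \<open>\<tau>\<^sup>2\<close>, and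
  \<open>\<bar>s - \<tau>\<bar>\<^sup>2 \<le> \<bar>s\<^sup>2 - \<tau>\<^sup>2\<bar>\<close>.\<close>


section \<open>Inner products\<close>

lemma cinner_add_left: "cinner (x + y) z = cinner x z + cinner (y::'a::complex_inner) z"
  by (metis cinner_add_right cinner_commute complex_cnj_add)

lemma cinner_scaleC_left: "cinner (a *\<^sub>C x) y = cnj a * cinner x (y::'a::complex_inner)"
  by (metis cinner_commute cinner_scaleC_right complex_cnj_mult)

lemma cinner_diff_right: "cinner x (y - z) = cinner x y - cinner x (z::'a::complex_inner)"
  by (metis add_diff_cancel_right' cinner_add_right diff_add_cancel)

lemma cinner_diff_left: "cinner (x - y) z = cinner x z - cinner (y::'a::complex_inner) z"
  by (metis add_diff_cancel_right' cinner_add_left diff_add_cancel)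

lemma cinner_scaleR_right: "cinner x (r *\<^sub>R y) = of_real r * cinner x (y::'a::complex_inner)"
  by (simp add: scaleR_scaleC cinner_scaleC_right)

lemma cinner_scaleR_left: "cinner (r *\<^sub>R x) y = of_real r * cinner x (y::'a::complex_inner)"
  by (simp add: scaleR_scaleC cinner_scaleC_left)

lemma Re_cinner_commute: "Re (cinner x y) = Re (cinner y (x::'a::complex_inner))"
  by (metis cinner_commute cnj.sel(1))

lemma Re_cinner_self: "Re (cinner x x) = (norm (x::'a::complex_inner))\<^sup>2"
  by (simp add: cinner_self)

lemma norm_add_sq:
  "(norm (x + y))\<^sup>2 = (norm x)\<^sup>2 + 2 * Re (cinner x y) + (norm (y::'a::complex_inner))\<^sup>2"
  using Re_cinner_commute[of y x]
  by (simp add: Re_cinner_self[symmetric] cinner_add_left cinner_add_right)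

lemma norm_diff_sq:
  "(norm (x - y))\<^sup>2 = (norm x)\<^sup>2 - 2 * Re (cinner x y) + (norm (y::'a::complex_inner))\<^sup>2"
  using Re_cinner_commute[of y x]
  by (simp add: Re_cinner_self[symmetric] cinner_diff_left cinner_diff_right)

text \<open>The class provides homogeneity of the norm for real scalars; the complex case is read
  off from \<open>cinner_self\<close>.\<close>

lemma norm_scaleC: "norm (a *\<^sub>C x) = cmod a * norm (x::'a::complex_inner)"
proof -
  have "complex_of_real ((norm (a *\<^sub>C x))\<^sup>2) = a * cnj a * cinner x x"
    by (simp only: cinner_self[symmetric] cinner_scaleC_left cinner_scaleC_right mult_ac)
  also have "\<dots> = complex_of_real ((cmod a * norm x)\<^sup>2)"
    by (simp add: cinner_self complex_norm_square[symmetric] power_mult_distrib)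
  finally have "(norm (a *\<^sub>C x))\<^sup>2 = (cmod a * norm x)\<^sup>2"
    using of_real_eq_iff by blast
  then show ?thesis
    by simp
qed

text \<open>Cauchy-Schwarz for the real part, from expanding the squared norm of
  \<open>norm y *\<^sub>R x - norm x *\<^sub>R y\<close>.\<close>

lemma Re_cinner_le_norm: "Re (cinner x y) \<le> norm x * norm (y::'a::complex_inner)"
proof -
  have "0 \<le> (norm (norm y *\<^sub>R x - norm x *\<^sub>R y))\<^sup>2"
    by simp
  also have "\<dots> = 2 * (norm x * norm y) * (norm x * norm y - Re (cinner x y))"
    unfolding norm_diff_sq
    by (simp add: cinner_scaleR_left cinner_scaleR_right power2_eq_square algebra_simps)
  finally have *: "0 \<le> 2 * (norm x * norm y) * (norm x * norm y - Re (cinner x y))" .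
  show ?thesis
  proof (cases "x = 0 \<or> y = 0")
    case True
    then show ?thesis
      using cinner_scaleR_left[of 0 x y] cinner_scaleR_right[of x 0 y] by auto
  next
    case False
    then have "0 < 2 * (norm x * norm y)" by simp
    with * show ?thesis
      by (simp add: zero_le_mult_iff)
  qed
qed

text \<open>The test vector is \<open>y - z\<close>, so it suffices that \<open>S\<close> contains
  it. Used with \<open>UNIV\<close> and with the range of a projection to show that adjoints are
  unique.\<close>

lemma cinner_ext:
  fixes y z :: "'a::complex_inner"
  assumes "y \<in> S" "z \<in> S" "y - z \<in> S" "\<And>x. x \<in> S \<Longrightarrow> cinner x y = cinner x z"
  shows "y = z"
proof -
  have "cinner (y - z) (y - z) = 0"
    using assms by (simp add: cinner_diff_right)
  then show ?thesis by (simp add: cinner_self)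
qed


section \<open>The Riesz representation theorem and adjoints\<close>

text \<open>The representing vector minimises \<open>\<parallel>x\<parallel>\<^sup>2 - 2 g x\<close>; by the parallelogram law every
  minimising sequence is Cauchy.\<close>

lemma riesz_representation_Re:
  fixes g :: "'h::chilbert_space \<Rightarrow> real"
  assumes "bounded_linear g"
  shows "\<exists>z. \<forall>x. g x = Re (cinner z x)"
proof -
  interpret g: bounded_linear g by fact
  define J where "J = (\<lambda>x. (norm x)\<^sup>2 - 2 * g x)"
  obtain K where K: "\<And>x. norm (g x) \<le> norm x * K" "K \<ge> 0"
    using g.nonneg_bounded by blast
  have J_ge: "J x \<ge> - K\<^sup>2" for x
  proof -
    have "g x \<le> norm x * K" using K(1)[of x] by simp
    moreover have "0 \<le> (norm x - K)\<^sup>2" by simp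
    ultimately show ?thesis by (simp add: J_def power2_diff)
  qed
  define d where "d = Inf (range J)"
  have bdd: "bdd_below (range J)" by (rule bdd_belowI2[OF J_ge])
  have d_le: "d \<le> J x" for x
    unfolding d_def by (rule cInf_lower) (auto simp: bdd)
  have "\<exists>x. J x < d + inverse (real (Suc n))" for n
  proof -
    have "Inf (range J) < d + inverse (real (Suc n))" by (simp add: d_def)
    then show ?thesis using cInf_less_iff[OF _ bdd] by auto
  qed
  then obtain X where X: "\<And>n. J (X n) < d + inverse (real (Suc n))" by metis
  \<comment> \<open>The parallelogram law in terms of \<open>J\<close>: the contributions of the
    linear functional \<open>g\<close> cancel.\<close>
  have par: "(norm (x - y))\<^sup>2 = 2 * J x + 2 * J y - 4 * J ((1/2) *\<^sub>R (x + y))" for x y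
  proof -
    have "(norm ((1/2) *\<^sub>R (x + y)))\<^sup>2 = (norm (x + y))\<^sup>2 / 4"
      by (simp add: power_divide)
    then show ?thesis
      by (simp add: J_def g.add g.scaleR norm_add_sq norm_diff_sq field_simps)
  qed
  have "Cauchy X"
  proof (rule CauchyI)
    fix e :: real assume "e > 0"
    then obtain N where N: "inverse (real (Suc N)) < e\<^sup>2 / 4"
      using reals_Archimedean[of "e\<^sup>2 / 4"] by auto
    have "norm (X m - X n) < e" if "m \<ge> N" "n \<ge> N" for m n
    proof -
      have *: "J (X k) < d + e\<^sup>2 / 4" if "k \<ge> N" for k
      proof -
        have "inverse (real (Suc k)) \<le> inverse (real (Suc N))" using that by simp
        then show ?thesis using X[of k] N by linarith
      qed
      have "(norm (X m - X n))\<^sup>2 < e\<^sup>2"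
        using par[of "X m" "X n"] *[OF that(1)] *[OF that(2)] d_le[of "(1/2) *\<^sub>R (X m + X n)"]
        by linarith
      then show ?thesis using \<open>e > 0\<close> by (simp add: power2_less_imp_less)
    qed
    then show "\<exists>M. \<forall>m\<ge>M. \<forall>n\<ge>M. norm (X m - X n) < e" by blast
  qed
  then obtain z where z: "X \<longlonglongrightarrow> z"
    using Cauchy_convergent convergent_def by blast
  have "(\<lambda>n. J (X n)) \<longlonglongrightarrow> J z"
    unfolding J_def by (intro tendsto_intros z g.tendsto)
  moreover have "(\<lambda>n. d + inverse (real (Suc n))) \<longlonglongrightarrow> d + 0"
    by (intro tendsto_intros LIMSEQ_inverse_real_of_nat)
  ultimately have Jz: "J z \<le> d"
    using X by (intro LIMSEQ_le[of "\<lambda>n. J (X n)" _ "\<lambda>n. d + inverse (real (Suc n))"])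
      (auto intro: less_imp_le)
  have "g h = Re (cinner z h)" for h
  proof -
    define a where "a = Re (cinner z h) - g h"
    define b where "b = (norm h)\<^sup>2"
    \<comment> \<open>Minimality of \<open>z\<close> is tested along \<open>h\<close>, where
      \<open>J\<close> changes by \<open>2 * t * a + t\<^sup>2 * b\<close>. This \<open>t\<close>
      makes the change equal to \<open>- t\<^sup>2 * (b + 2)\<close>; dividing by
      \<open>b + 1\<close> instead of \<open>b\<close> covers \<open>h = 0\<close>.\<close>
    define t where "t = - a / (b + 1)"
    have b: "b \<ge> 0" by (simp add: b_def)
    have "J z \<le> J (z + t *\<^sub>R h)" using Jz d_le order_trans by blast
    then have "0 \<le> 2 * t * a + t\<^sup>2 * b"
      by (simp add: J_def a_def b_def g.add g.scaleR norm_add_sq cinner_scaleR_right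
          algebra_simps)
    moreover have a: "a = - t * (b + 1)"
      using b by (simp add: t_def)
    ultimately have "t\<^sup>2 * (b + 2) \<le> 0"
      by (simp add: power2_eq_square algebra_simps)
    then have "t = 0" using b by (simp add: mult_le_0_iff)
    then have "a = 0" using a by simp
    then show ?thesis by (simp add: a_def)
  qed
  then show ?thesis by blast
qed

text \<open>Gives access to the real notion \<open>bounded_linear\<close> of the library, with
  complex homogeneity as a separate conjunct.\<close>

lemma bounded_op_on_UNIV_iff:
  "bounded_op_on UNIV X \<longleftrightarrow> bounded_linear X \<and> (\<forall>c x. X (c *\<^sub>C x) = c *\<^sub>C X x)"
proof
  assume *: "bounded_op_on UNIV X"
  then obtain K where "\<And>x. norm (X x) \<le> norm x * K"
    by (auto simp: bounded_op_on_def mult.commute)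
  with * have "bounded_linear X"
    by (intro bounded_linear_intro[of X K]) (auto simp: bounded_op_on_def scaleR_scaleC)
  with * show "bounded_linear X \<and> (\<forall>c x. X (c *\<^sub>C x) = c *\<^sub>C X x)"
    by (auto simp: bounded_op_on_def)
next
  assume *: "bounded_linear X \<and> (\<forall>c x. X (c *\<^sub>C x) = c *\<^sub>C X x)"
  then interpret bounded_linear X by simp
  show "bounded_op_on UNIV X"
    using * bounded by (auto simp: bounded_op_on_def add mult.commute)
qed

text \<open>Makes the description \<open>THE\<close> in \<open>adjoint_on\<close> usable on the
  whole space: Riesz gives existence for the real part, replacing \<open>x\<close> by
  \<open>\<i> *\<^sub>C x\<close> gives the imaginary part, and \<open>cinner_ext\<close> gives
  uniqueness.\<close>

lemma cinner_adjoint_on: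
  fixes T :: "'h::chilbert_space \<Rightarrow> 'h"
  assumes "bounded_op_on UNIV T"
  shows "cinner (T x) y = cinner x (adjoint_on UNIV T y)"
proof -
  have T: "bounded_linear T" "T (c *\<^sub>C x) = c *\<^sub>C T x" for c x
    using assms by (auto simp: bounded_op_on_UNIV_iff)
  interpret T: bounded_linear T by fact
  have "bounded_linear (\<lambda>x. Re (cinner y (T x)))"
  proof (rule bounded_linear_intro)
    fix x
    have "- Re (cinner y (T x)) \<le> norm y * norm (T x)"
      using Re_cinner_le_norm[of y "- T x"] cinner_diff_right[of y 0 "T x"]
        cinner_diff_right[of y 0 0] by simp
    then have "norm (Re (cinner y (T x))) \<le> norm y * norm (T x)"
      using Re_cinner_le_norm[of y "T x"] by simp
    also have "\<dots> \<le> norm y * (onorm T * norm x)"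
      by (intro mult_left_mono onorm T) auto
    finally show "norm (Re (cinner y (T x))) \<le> norm x * (norm y * onorm T)"
      by (simp add: mult_ac)
  qed (simp_all add: T.add T.scaleR cinner_add_right cinner_scaleR_right)
  then obtain z where z: "Re (cinner y (T x)) = Re (cinner z x)" for x
    using riesz_representation_Re by metis
  have "Im (cinner y (T x)) = Im (cinner z x)" for x
    using z[of "\<i> *\<^sub>C x"] by (simp add: T cinner_scaleC_right)
  with z have "cinner y (T x) = cinner z x" for x
    by (simp add: complex_eq_iff)
  then have *: "cinner (T x) y = cinner x z" for x
    by (metis cinner_commute)
  have "adjoint_on UNIV T y = z"
    unfolding adjoint_on_def
  proof (rule the_equality)
    fix w assume "w \<in> UNIV \<and> (\<forall>x\<in>UNIV. cinner (T x) y = cinner x w)"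
    then show "w = z" using * by (intro cinner_ext[of _ UNIV]) auto
  qed (simp add: *)
  then show ?thesis using * by simp
qed


section \<open>Invertibility and lower bounds\<close>

text \<open>Stands in for invertibility: necessary on \<open>UNIV\<close>, and sufficient on a
  finite-dimensional subspace that a bounded operator maps into itself. So its failure produces
  spectral points on the whole space, while a singular matrix produces approximate kernel
  vectors.\<close>

definition bounded_below_on :: "'h::chilbert_space set \<Rightarrow> ('h \<Rightarrow> 'h) \<Rightarrow> bool" where
  "bounded_below_on S X \<longleftrightarrow> (\<exists>c>0. \<forall>x\<in>S. c * norm x \<le> norm (X x))"

lemma bounded_op_on_minus:
  assumes "bounded_op_on UNIV X"
  shows "bounded_op_on UNIV (\<lambda>x. z *\<^sub>C x - X x)"
proof -
  interpret X: bounded_linear X using assms by (simp add: bounded_op_on_UNIV_iff)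
  have "bounded_linear (\<lambda>x::'a. z *\<^sub>C x)"
    by (rule bounded_linear_intro[where K = "cmod z"])
      (simp_all add: scaleC_add_right scaleR_scaleC norm_scaleC mult.commute)
  then show ?thesis
    using assms by (auto simp: bounded_op_on_UNIV_iff complex_vector.scale_right_diff_distrib mult.commute intro: bounded_linear_sub)
qed

text \<open>The supremum in \<open>onorm_on\<close> is a real one, so the quotients must first be
  shown bounded; at \<open>x = 0\<close> the quotient is 0 by convention.\<close>

lemma onorm_on_upper:
  assumes "bounded_op_on S Y" "x \<in> S"
  shows "norm (Y x) \<le> onorm_on S Y * norm x"
proof -
  obtain K where K: "\<And>x. x \<in> S \<Longrightarrow> norm (Y x) \<le> K * norm x"
    using assms unfolding bounded_op_on_def by blast
  have "bdd_above ((\<lambda>x. norm (Y x) / norm x) ` S)"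
  proof (rule bdd_aboveI2)
    show "norm (Y x) / norm x \<le> \<bar>K\<bar>" if "x \<in> S" for x
    proof (cases "x = 0")
      case False
      then show ?thesis using K[OF that] by (simp add: divide_le_eq) 
          (smt (verit) mult_right_mono norm_ge_zero)
    qed simp
  qed
  then have "norm (Y x) / norm x \<le> onorm_on S Y"
    unfolding onorm_on_def using assms by (intro cSUP_upper)
  then show ?thesis
    using K[OF assms(2)] by (cases "x = 0") (auto simp: divide_le_eq)
qed

lemma bounded_below_on_if_invertible_on:
  assumes "invertible_on UNIV X"
  shows "bounded_below_on UNIV X"
proof -
  obtain Y where Y: "bounded_op_on UNIV Y" "\<And>x. Y (X x) = x"
    using assms by (auto simp: invertible_on_def inverse_op_on_def)
  \<comment> \<open>The absolute value and \<open>+ 1\<close> keep the constant positive, also on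
    the trivial space, where the norm of the inverse is 0.\<close>
  have "inverse (\<bar>onorm_on UNIV Y\<bar> + 1) * norm x \<le> norm (X x)" for x
  proof -
    have "norm x \<le> onorm_on UNIV Y * norm (X x)"
      using onorm_on_upper[OF Y(1), of "X x"] Y(2) by simp
    also have "\<dots> \<le> (\<bar>onorm_on UNIV Y\<bar> + 1) * norm (X x)"
      by (intro mult_right_mono) auto
    finally show ?thesis by (simp add: field_simps)
  qed
  then show ?thesis
    unfolding bounded_below_on_def by (intro exI[of _ "inverse (\<bar>onorm_on UNIV Y\<bar> + 1)"]) auto
qed

text \<open>A lower bound makes \<open>X\<close> injective on \<open>S\<close>, a dimension count
  makes it surjective, and the same bound makes the inverse bounded by \<open>1 / c\<close>.\<close>

lemma invertible_on_finite_dim: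
  fixes X :: "'h::chilbert_space \<Rightarrow> 'h"
  assumes X: "bounded_op_on UNIV X" and XS: "X ` S \<subseteq> S"
    and S: "complex_vector.subspace S" "finite B" "S \<subseteq> complex_vector.span B"
    and bb: "bounded_below_on S X"
  shows "invertible_on S X"
proof -
  have lin: "bounded_linear X" "X (c *\<^sub>C x) = c *\<^sub>C X x" for c x
    using X by (auto simp: bounded_op_on_UNIV_iff)
  interpret X: bounded_linear X by fact
  interpret L: Vector_Spaces.linear "scaleC :: complex \<Rightarrow> 'h \<Rightarrow> 'h" "scaleC :: complex \<Rightarrow> 'h \<Rightarrow> 'h" X
    by unfold_locales (simp_all add: lin X.add)
  obtain c where c: "c > 0" "\<And>x. x \<in> S \<Longrightarrow> c * norm x \<le> norm (X x)"
    using bb by (auto simp: bounded_below_on_def)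
  have diff: "x - y \<in> S" if "x \<in> S" "y \<in> S" for x y
    using that S(1) complex_vector.subspace_diff by blast
  have inj: "inj_on X S"
  proof (rule inj_onI)
    fix x y assume "x \<in> S" "y \<in> S" "X x = X y"
    with c(2)[of "x - y"] diff have "c * norm (x - y) \<le> 0" by (simp add: X.diff)
    then show "x = y" using c(1) by (simp add: mult_le_0_iff)
  qed
  obtain C where C: "C \<subseteq> S" "complex_vector.independent C" "S \<subseteq> complex_vector.span C"
    using complex_vector.maximal_independent_subset[of S] by blast
  have spanC: "complex_vector.span C = S"
    using C S(1) complex_vector.span_minimal by blast
  have finC: "finite C"
    using complex_vector.independent_span_bound[of B C] C S by blast
  have indep: "complex_vector.independent (X ` C)"
    using L.independent_inj_on_image[of C] C(2) inj spanC by simp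
  have sub: "X ` C \<subseteq> S" using C XS by blast
  have surj: "y \<in> X ` S" if y: "y \<in> S" for y
  proof (rule ccontr)
    assume "y \<notin> X ` S"
    moreover have "complex_vector.span (X ` C) = X ` S"
      using L.span_image[of C] spanC by simp
    ultimately have y': "y \<notin> complex_vector.span (X ` C)" by simp
    \<comment> \<open>A vector outside the image would extend the image of the basis
      \<open>C\<close> to an independent set in \<open>S\<close> with more than
      \<open>card C\<close> elements.\<close>
    then have "complex_vector.independent (insert y (X ` C))"
      using indep by (simp add: complex_vector.independent_insert complex_vector.span_base)
    then have "card (insert y (X ` C)) \<le> card C"
      using complex_vector.independent_span_bound[OF finC, of "insert y (X ` C)"] spanC sub y by simp
    moreover have "card (X ` C) = card C" using inj C(1) by (meson card_image inj_on_subset)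
    moreover have "y \<notin> X ` C" using y' by (metis complex_vector.span_base)
    ultimately show False using finC by simp
  qed
  define Y where "Y = inv_into S X"
  have YX: "Y (X x) = x" if "x \<in> S" for x
    using inj that by (simp add: Y_def)
  have XY: "X (Y y) = y" and YS: "Y y \<in> S" if "y \<in> S" for y
    using surj[OF that] by (auto simp: Y_def f_inv_into_f intro: inv_into_into)
  have add: "x + y \<in> S" if "x \<in> S" "y \<in> S" for x y
    using that S(1) complex_vector.subspace_add by blast
  have scale: "a *\<^sub>C x \<in> S" if "x \<in> S" for a x
    using that S(1) complex_vector.subspace_scale by blast
  have "bounded_op_on S Y"
    unfolding bounded_op_on_def
  proof (intro conjI ballI allI exI[of _ "1 / c"])
    show "Y ` S \<subseteq> S" using YS by blast
    fix x assume x: "x \<in> S"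
    show "Y (x + y) = Y x + Y y" if "y \<in> S" for y
      using YX[of "Y x + Y y"] by (simp add: X.add XY YS x that add)
    show "Y (a *\<^sub>C x) = a *\<^sub>C Y x" for a
      using YX[of "a *\<^sub>C Y x"] by (simp add: lin XY YS x scale)
    show "norm (Y x) \<le> 1 / c * norm x"
      using c(2)[OF YS[OF x]] c(1) by (simp add: XY x field_simps)
  qed
  then show ?thesis
    using XY YX by (auto simp: invertible_on_def inverse_op_on_def)
qed

lemma invertible_on_cong:
  assumes "\<And>x. x \<in> S \<Longrightarrow> X x = X' x"
  shows "invertible_on S X \<longleftrightarrow> invertible_on S X'"
proof -
  have "inverse_op_on S X Y \<longleftrightarrow> inverse_op_on S X' Y" for Y
    using assms by (auto simp: inverse_op_on_def bounded_op_on_def image_subset_iff)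
  then show ?thesis by (simp add: invertible_on_def)
qed

text \<open>If \<open>X\<close> is invertible, a vector \<open>y\<close> that nearly attains the
  norm of the inverse \<open>Y\<close> gives \<open>x = Y y\<close>; the gap between
  \<open>\<epsilon>\<close> and \<open>\<eta>\<close> allows for a supremum that is not attained.
  Otherwise finite dimension rules out a lower bound.\<close>

lemma approx_kernel_if_inverse_norm_ge:
  fixes X :: "'h::chilbert_space \<Rightarrow> 'h"
  assumes X: "bounded_op_on UNIV X" "X ` S \<subseteq> S"
    and S: "complex_vector.subspace S" "finite B" "S \<subseteq> complex_vector.span B"
    and ge: "inverse_norm_on S X \<ge> ereal (1 / \<epsilon>)" and "0 < \<epsilon>" "\<epsilon> < \<eta>"
  shows "\<exists>x\<in>S. norm (X x) < \<eta> * norm x"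
proof (cases "invertible_on S X")
  case False
  then have "\<not> bounded_below_on S X"
    using invertible_on_finite_dim assms by blast
  then show ?thesis
    using \<open>0 < \<epsilon>\<close> \<open>\<epsilon> < \<eta>\<close> by (force simp: bounded_below_on_def not_le)
next
  case True
  define Y where "Y = (SOME Y. inverse_op_on S X Y)"
  have Y: "inverse_op_on S X Y"
    using True unfolding Y_def invertible_on_def by (rule someI_ex)
  have "1 / \<epsilon> \<le> onorm_on S Y"
    using ge True by (simp add: inverse_norm_on_def Y_def)
  moreover have "1 / \<eta> < 1 / \<epsilon>"
    using \<open>0 < \<epsilon>\<close> \<open>\<epsilon> < \<eta>\<close> by (simp add: frac_less2)
  ultimately have "1 / \<eta> < (SUP y\<in>S. norm (Y y) / norm y)"
    by (simp add: onorm_on_def)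
  moreover have "S \<noteq> {}" using S(1) complex_vector.subspace_0 by blast
  ultimately obtain y where y: "y \<in> S" "1 / \<eta> < norm (Y y) / norm y"
    using cSUP_least[of S "\<lambda>y. norm (Y y) / norm y" "1 / \<eta>"] by (meson not_le)
  have "y \<noteq> 0" using y \<open>0 < \<epsilon>\<close> \<open>\<epsilon> < \<eta>\<close> by auto
  then have "norm y < \<eta> * norm (Y y)"
    using y \<open>0 < \<epsilon>\<close> \<open>\<epsilon> < \<eta>\<close> by (simp add: field_simps)
  moreover have "X (Y y) = y" "Y y \<in> S"
    using Y y by (auto simp: inverse_op_on_def bounded_op_on_def)
  ultimately show ?thesis by (intro bexI[of _ "Y y"]) auto
qed

text \<open>A vector with \<open>norm (X x) < \<eta> * norm x\<close> forces any inverse to have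
  norm above \<open>1 / \<eta>\<close>, and \<open>\<eta>\<close> may be arbitrarily close to
  \<open>r\<close>.\<close>

lemma inverse_norm_ge_if_approx_kernel:
  assumes "\<And>\<eta>. r < \<eta> \<Longrightarrow> \<exists>x. norm (X x) < \<eta> * norm x" and "0 < r"
  shows "inverse_norm_on UNIV X \<ge> ereal (1 / r)"
proof (cases "invertible_on UNIV X")
  case False
  then show ?thesis by (simp add: inverse_norm_on_def)
next
  case True
  define Y where "Y = (SOME Y. inverse_op_on UNIV X Y)"
  have Y: "inverse_op_on UNIV X Y"
    using True unfolding Y_def invertible_on_def by (rule someI_ex)
  have "1 / r \<le> onorm_on UNIV Y"
  proof (rule ccontr)
    assume *: "\<not> 1 / r \<le> onorm_on UNIV Y"
    define k where "k = onorm_on UNIV Y"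
    have kr: "k * r < 1" using * \<open>0 < r\<close> by (simp add: k_def field_simps)
    \<comment> \<open>For \<open>k > 0\<close>, \<open>k * r < 1\<close> makes \<open>1 / k\<close>
      admissible. For \<open>k \<le> 0\<close> any value above \<open>r\<close> does, since the
      vector obtained forces \<open>k > 0\<close>.\<close>
    define \<eta> where "\<eta> = (if k \<le> 0 then r + 1 else 1 / k)"
    have eta: "r < \<eta>" "k * \<eta> \<le> 1"
      using kr \<open>0 < r\<close> by (auto simp: \<eta>_def field_simps intro: order_trans[of _ 0] mult_nonpos_nonneg)
    obtain x where x: "norm (X x) < \<eta> * norm x" using assms(1)[OF eta(1)] by blast
    have "norm x \<le> k * norm (X x)"
      using onorm_on_upper[of UNIV Y "X x"] Y by (simp add: inverse_op_on_def k_def)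
    moreover have "x \<noteq> 0" using x by auto
    ultimately have "0 < k * norm (X x)" by (smt (verit) zero_less_norm_iff)
    then have "0 < k" by (simp add: zero_less_mult_iff)
    with x have "k * norm (X x) < k * (\<eta> * norm x)" by simp
    also have "\<dots> \<le> norm x" using eta(2) by (metis mult.assoc mult_left_le_one_le mult_1 mult_right_mono norm_ge_zero)
    finally show False using \<open>norm x \<le> k * norm (X x)\<close> by simp
  qed
  then show ?thesis using True by (simp add: inverse_norm_on_def Y_def)
qed


section \<open>Spectra of self-adjoint operators near approximate eigenvalues\<close>

text \<open>Let \<open>m\<close> be the infimum of \<open>\<parallel>B x\<parallel>\<close> over unit vectors. The form of \<open>C = B\<^sup>2 - m\<^sup>2\<close> is
  nonnegative with infimum \<open>0\<close>, and evaluating it at \<open>x - t C x\<close> bounds \<open>\<parallel>C x\<parallel>\<^sup>2\<close> by a multiple of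
  its value at \<open>x\<close>. So \<open>C = (B - m) (B + m)\<close> is not bounded below.\<close>

lemma approx_eigenvalue_selfadjoint:
  fixes B :: "'h::chilbert_space \<Rightarrow> 'h"
  assumes "bounded_linear B" and sym: "\<And>x y. cinner (B x) y = cinner x (B y)"
    and approx: "\<And>\<eta>. r < \<eta> \<Longrightarrow> \<exists>x. norm (B x) < \<eta> * norm x"
  shows "\<exists>t. \<bar>t\<bar> \<le> r \<and> \<not> bounded_below_on UNIV (\<lambda>x. B x - t *\<^sub>R x)"
proof -
  interpret B: bounded_linear B by fact
  obtain K where K: "K > 0" "\<And>x. norm (B x) \<le> norm x * K" using B.pos_bounded by blast
  \<comment> \<open>Zero is excluded: its quotient is 0 by convention and would make the infimum
    0.\<close>
  let ?R = "(\<lambda>x. norm (B x) / norm x) ` (- {0})"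
  define m where "m = Inf ?R"
  have bdd: "bdd_below ?R" by (rule bdd_belowI2[of _ 0]) simp
  have approx': "\<exists>a\<in>?R. a < \<eta>" if eta: "r < \<eta>" for \<eta>
  proof -
    obtain x where x: "norm (B x) < \<eta> * norm x" using approx[OF eta] by blast
    then have "x \<noteq> 0" by auto
    with x show ?thesis by (auto simp: field_simps intro!: bexI[of _ x])
  qed
  have ne: "?R \<noteq> {}" using approx'[of "r + 1"] by auto
  have m_le: "m * norm x \<le> norm (B x)" for x
  proof (cases "x = 0")
    case False
    then have "m \<le> norm (B x) / norm x" unfolding m_def by (intro cInf_lower bdd) auto
    then show ?thesis using False by (simp add: field_simps)
  qed simp
  have m0: "m \<ge> 0" unfolding m_def using ne by (intro cInf_greatest) auto
  have mr: "m \<le> r"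
  proof (rule ccontr)
    assume "\<not> m \<le> r"
    then obtain a where "a \<in> ?R" "a < m" using approx'[of m] by auto
    then show False using cInf_lower[OF _ bdd] m_def by fastforce
  qed
  have "\<not> (bounded_below_on UNIV (\<lambda>x. B x - m *\<^sub>R x) \<and> bounded_below_on UNIV (\<lambda>x. B x - (- m) *\<^sub>R x))"
  proof
    assume "bounded_below_on UNIV (\<lambda>x. B x - m *\<^sub>R x) \<and> bounded_below_on UNIV (\<lambda>x. B x - (- m) *\<^sub>R x)"
    then obtain c1 c2 where c: "c1 > 0" "c2 > 0" "\<And>x. c1 * norm x \<le> norm (B x - m *\<^sub>R x)"
      "\<And>x. c2 * norm x \<le> norm (B x + m *\<^sub>R x)"
      by (auto simp: bounded_below_on_def)
    define C where "C = (\<lambda>x. B (B x) - m\<^sup>2 *\<^sub>R x)"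
    have C_ge: "c1 * c2 * norm x \<le> norm (C x)" for x
    proof -
      have "c1 * (c2 * norm x) \<le> c1 * norm (B x + m *\<^sub>R x)"
        using c by simp
      also have "\<dots> \<le> norm (B (B x + m *\<^sub>R x) - m *\<^sub>R (B x + m *\<^sub>R x))" by (rule c)
      also have "\<dots> = norm (C x)"
        by (simp add: C_def B.add B.scaleR algebra_simps power2_eq_square)
      finally show ?thesis by (simp add: mult.assoc)
    qed
    have C_le: "(norm (C x))\<^sup>2 / K\<^sup>2 \<le> (norm (B x))\<^sup>2 - m\<^sup>2 * (norm x)\<^sup>2" for x
    proof -
      \<comment> \<open>Write \<open>Q x\<close> for the right-hand side of \<open>C_le\<close>.
        Then \<open>Q y\<close> is
        \<open>Q x - 2 * t * (norm (C x))\<^sup>2 + t\<^sup>2 * Q (C x)\<close>, where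
        \<open>Q (C x)\<close> is at most \<open>K\<^sup>2 * (norm (C x))\<^sup>2\<close>; this
        \<open>t\<close> is optimal for that bound.\<close>
      define t where "t = 1 / K\<^sup>2"
      define y where "y = x - t *\<^sub>R C x"
      have "(m * norm y)\<^sup>2 \<le> (norm (B y))\<^sup>2"
        using m_le[of y] m0 by (intro power_mono) auto
      then have "0 \<le> (norm (B y))\<^sup>2 - m\<^sup>2 * (norm y)\<^sup>2"
        by (simp add: power_mult_distrib)
      also have "(norm (B y))\<^sup>2 = (norm (B x))\<^sup>2 - 2 * t * Re (cinner (B (B x)) (C x)) + t\<^sup>2 * (norm (B (C x)))\<^sup>2"
        unfolding sym[of "B x"] y_def
        by (simp add: B.diff B.scaleR norm_diff_sq cinner_scaleR_right power_mult_distrib)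
      also have "(norm y)\<^sup>2 = (norm x)\<^sup>2 - 2 * t * Re (cinner x (C x)) + t\<^sup>2 * (norm (C x))\<^sup>2"
        unfolding y_def by (simp add: norm_diff_sq cinner_scaleR_right power_mult_distrib)
      also have "Re (cinner (B (B x)) (C x)) = (norm (C x))\<^sup>2 + m\<^sup>2 * Re (cinner x (C x))"
      proof -
        have "B (B x) = C x + m\<^sup>2 *\<^sub>R x" by (simp add: C_def)
        then show ?thesis
          by (simp add: cinner_add_left cinner_scaleR_left Re_cinner_self)
      qed
      finally have "2 * t * (norm (C x))\<^sup>2 \<le> (norm (B x))\<^sup>2 - m\<^sup>2 * (norm x)\<^sup>2
          + t\<^sup>2 * (norm (B (C x)))\<^sup>2 - m\<^sup>2 * t\<^sup>2 * (norm (C x))\<^sup>2"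
        by (simp add: algebra_simps)
      moreover have "t\<^sup>2 * (norm (B (C x)))\<^sup>2 \<le> t * (norm (C x))\<^sup>2"
      proof -
        have "t\<^sup>2 * (norm (B (C x)))\<^sup>2 \<le> t\<^sup>2 * (norm (C x) * K)\<^sup>2"
          using K by (intro mult_left_mono power_mono) auto
        also have "\<dots> = t * (norm (C x))\<^sup>2"
          using K(1) by (simp add: t_def power2_eq_square)
        finally show ?thesis .
      qed
      moreover have "0 \<le> m\<^sup>2 * t\<^sup>2 * (norm (C x))\<^sup>2" by simp
      ultimately have "t * (norm (C x))\<^sup>2 \<le> (norm (B x))\<^sup>2 - m\<^sup>2 * (norm x)\<^sup>2" by linarith
      then show ?thesis by (simp add: t_def)
    qed
    \<comment> \<open>\<open>C_ge\<close> and \<open>C_le\<close> together raise the lower bound of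
      \<open>B\<close> from \<open>m\<close> to \<open>sqrt (m\<^sup>2 + e)\<close>, contradicting
      the choice of \<open>m\<close> as infimum.\<close>
    define e where "e = (c1 * c2 / K)\<^sup>2"
    have e: "e > 0" using c K by (simp add: e_def)
    have "(m\<^sup>2 + e) * (norm x)\<^sup>2 \<le> (norm (B x))\<^sup>2" for x
    proof -
      have "(c1 * c2 * norm x)\<^sup>2 / K\<^sup>2 \<le> (norm (C x))\<^sup>2 / K\<^sup>2"
        using C_ge[of x] c by (intro divide_right_mono power_mono) auto
      then show ?thesis
        using C_le[of x] by (simp add: e_def power_divide power_mult_distrib algebra_simps)
    qed
    then have ge: "sqrt (m\<^sup>2 + e) * norm x \<le> norm (B x)" for x
      using real_le_rsqrt real_sqrt_le_mono[of "(m\<^sup>2 + e) * (norm x)\<^sup>2" "(norm (B x))\<^sup>2"]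
      by (simp add: real_sqrt_mult)
    have "sqrt (m\<^sup>2 + e) \<le> m"
    proof (subst (2) m_def, rule cInf_greatest[OF ne])
      fix a assume "a \<in> ?R"
      then obtain x where x: "a = norm (B x) / norm x" "0 < norm x" by auto
      with ge[of x] show "sqrt (m\<^sup>2 + e) \<le> a"
        by (simp only: x pos_le_divide_eq)
    qed
    moreover have "m < sqrt (m\<^sup>2 + e)" using e by (simp add: real_less_rsqrt)
    ultimately show False by simp
  qed
  then show ?thesis
    using m0 mr by (metis abs_minus_cancel abs_of_nonneg)
qed

text \<open>Linearity follows from uniqueness of the representing vector, and the norm bound from
  pairing the adjoint of \<open>T\<close> at \<open>y\<close> with itself.\<close>

lemma
  fixes T :: "'h::chilbert_space \<Rightarrow> 'h"
  assumes T: "bounded_op_on UNIV T"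
  shows bounded_op_adjoint: "bounded_op_on UNIV (adjoint_on UNIV T)"
    and norm_adjoint_le: "norm (adjoint_on UNIV T y) \<le> onorm T * norm y"
    and cinner_adjoint_left: "cinner (adjoint_on UNIV T x) y = cinner x (T y)"
proof -
  let ?A = "adjoint_on UNIV T"
  note adj = cinner_adjoint_on[OF T, symmetric]
  have blT: "bounded_linear T" using T by (simp add: bounded_op_on_UNIV_iff)
  show "cinner (?A x) y = cinner x (T y)" for x y
    using adj by (metis cinner_commute)
  have le: "norm (?A y) \<le> onorm T * norm y" for y
  proof (cases "?A y = 0")
    case True
    then show ?thesis using onorm_pos_le[OF blT] by simp
  next
    case False
    have "(norm (?A y))\<^sup>2 = Re (cinner (T (?A y)) y)"
      by (simp add: Re_cinner_self[symmetric] adj)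
    also have "\<dots> \<le> norm (T (?A y)) * norm y"
      by (rule Re_cinner_le_norm)
    also have "\<dots> \<le> onorm T * norm (?A y) * norm y"
      by (intro mult_right_mono onorm blT) auto
    finally show ?thesis using False by (simp add: power2_eq_square)
  qed
  then show "norm (?A y) \<le> onorm T * norm y" .
  have "?A (x + y) = ?A x + ?A y" for x y
    by (rule cinner_ext[of _ UNIV]) (simp_all add: adj cinner_add_right)
  moreover have "?A (c *\<^sub>C x) = c *\<^sub>C ?A x" for c x
    by (rule cinner_ext[of _ UNIV]) (simp_all add: adj cinner_scaleC_right)
  ultimately show "bounded_op_on UNIV ?A"
    using le by (auto simp: bounded_op_on_def)
qed

text \<open>\<open>approx_eigenvalue_selfadjoint\<close> is applied to \<open>A - s\<^sup>2\<close>,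
  where \<open>A\<close> is the adjoint of \<open>T\<close> composed with \<open>T\<close>; it gives
  a spectral point of \<open>A\<close> within \<open>r\<close> of \<open>s\<^sup>2\<close>.\<close>

lemma singular_value_near:
  fixes T :: "'h::chilbert_space \<Rightarrow> 'h"
  assumes T: "bounded_op_on UNIV T" and "0 \<le> s"
    and approx: "\<And>\<eta>. r < \<eta> \<Longrightarrow>
      \<exists>x. norm (adjoint_on UNIV T (T x) - s\<^sup>2 *\<^sub>R x) < \<eta> * norm x"
  shows "\<exists>\<tau>\<in>singular_values_on UNIV T. cmod (complex_of_real s - \<tau>) \<le> sqrt r"
proof -
  define A where "A = (\<lambda>x. adjoint_on UNIV T (T x))"
  have blT: "bounded_linear T" and blS: "bounded_linear (adjoint_on UNIV T)"
    using T bounded_op_adjoint[OF T] by (simp_all add: bounded_op_on_UNIV_iff)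
  have A: "bounded_linear A"
    unfolding A_def using bounded_linear_compose[OF blS blT] by simp
  have symA: "cinner (A x) y = cinner x (A y)" for x y
    by (simp add: A_def cinner_adjoint_left[OF T] cinner_adjoint_on[OF T, symmetric])
  define B where "B = (\<lambda>x. A x - s\<^sup>2 *\<^sub>R x)"
  have "\<exists>t. \<bar>t\<bar> \<le> r \<and> \<not> bounded_below_on UNIV (\<lambda>x. B x - t *\<^sub>R x)"
  proof (rule approx_eigenvalue_selfadjoint)
    show "bounded_linear B"
      unfolding B_def by (intro bounded_linear_sub A bounded_linear_scaleR_right)
    show "cinner (B x) y = cinner x (B y)" for x y
      by (simp add: B_def symA cinner_diff_left cinner_diff_right cinner_scaleR_left cinner_scaleR_right)
    show "\<exists>x. norm (B x) < \<eta> * norm x" if "r < \<eta>" for \<eta>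
      using approx[OF that] by (simp add: B_def A_def)
  qed
  then obtain t where t: "\<bar>t\<bar> \<le> r" "\<not> bounded_below_on UNIV (\<lambda>x. B x - t *\<^sub>R x)"
    by blast
  define \<mu> where "\<mu> = s\<^sup>2 + t"
  have nb: "\<not> bounded_below_on UNIV (\<lambda>x. A x - \<mu> *\<^sub>R x)"
    using t(2) by (simp add: B_def \<mu>_def scaleR_add_left diff_diff_add)
  \<comment> \<open>The form of \<open>A\<close> is nonnegative, so \<open>A - \<mu>\<close> would
    be bounded below by \<open>- \<mu>\<close> if \<open>\<mu>\<close> were negative. Hence
    \<open>\<mu>\<close> has a real square root.\<close>
  have "\<mu> \<ge> 0"
  proof (rule ccontr)
    assume neg: "\<not> \<mu> \<ge> 0"
    have "- \<mu> * norm x \<le> norm (A x - \<mu> *\<^sub>R x)" for x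
    proof (cases "x = 0")
      case False
      have "Re (cinner (A x) x) = (norm (T x))\<^sup>2"
        by (simp add: A_def cinner_adjoint_left[OF T] Re_cinner_self)
      then have "- \<mu> * (norm x)\<^sup>2 \<le> Re (cinner (A x - \<mu> *\<^sub>R x) x)"
        by (simp add: cinner_diff_left cinner_scaleR_left Re_cinner_self)
      also have "\<dots> \<le> norm (A x - \<mu> *\<^sub>R x) * norm x"
        by (rule Re_cinner_le_norm)
      finally have "(- \<mu> * norm x) * norm x \<le> norm (A x - \<mu> *\<^sub>R x) * norm x"
        by (simp add: power2_eq_square)
      with False show ?thesis by (simp only: mult_le_cancel_right_pos zero_less_norm_iff not_False_eq_True)
    qed simp
    then have "bounded_below_on UNIV (\<lambda>x. A x - \<mu> *\<^sub>R x)"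
      unfolding bounded_below_on_def using neg by (intro exI[of _ "- \<mu>"]) auto
    with nb show False ..
  qed
  define \<tau> where "\<tau> = sqrt \<mu>"
  have \<tau>: "\<tau> \<ge> 0" "\<tau>\<^sup>2 = \<mu>" using \<open>\<mu> \<ge> 0\<close> by (simp_all add: \<tau>_def)
  have "\<not> bounded_below_on UNIV (\<lambda>x. (complex_of_real \<tau>)\<^sup>2 *\<^sub>C x - A x)"
  proof -
    have "(complex_of_real \<tau>)\<^sup>2 *\<^sub>C x = \<mu> *\<^sub>R x" for x :: 'h
      using \<tau>(2) by (simp add: scaleR_scaleC flip: of_real_power)
    then show ?thesis using nb by (simp add: bounded_below_on_def norm_minus_commute)
  qed
  then have "(complex_of_real \<tau>)\<^sup>2 \<in> spectrum_on UNIV (adjoint_on UNIV T \<circ> T)"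
    using bounded_below_on_if_invertible_on by (auto simp: spectrum_on_def A_def)
  then have "complex_of_real \<tau> \<in> singular_values_on UNIV T"
    using \<tau>(1) by (auto simp: singular_values_on_def)
  moreover have "\<bar>s - \<tau>\<bar> \<le> sqrt r"
  proof (rule real_le_rsqrt)
    have "\<bar>s - \<tau>\<bar>\<^sup>2 \<le> \<bar>s - \<tau>\<bar> * \<bar>s + \<tau>\<bar>"
      unfolding power2_eq_square using \<open>0 \<le> s\<close> \<tau>(1) by (intro mult_left_mono) auto
    also have "\<dots> = \<bar>t\<bar>"
      using \<tau>(2) by (simp add: \<mu>_def abs_mult[symmetric] power2_eq_square algebra_simps)
    finally show "\<bar>s - \<tau>\<bar>\<^sup>2 \<le> r" using t(1) by simp
  qed
  ultimately show ?thesis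
    by (metis norm_of_real of_real_diff)
qed


section \<open>Compressions to finite-dimensional subspaces\<close>

lemma bounded_op_on_comp:
  assumes "bounded_op_on UNIV X" "bounded_op_on UNIV Y"
  shows "bounded_op_on UNIV (X \<circ> Y)"
  using assms bounded_linear_compose[of X Y] by (auto simp: bounded_op_on_UNIV_iff o_def)

context
  fixes P :: "'h::chilbert_space \<Rightarrow> 'h"
  assumes P: "finite_rank_projection P"
begin

lemma bounded_op_proj: "bounded_op_on UNIV P"
  using P by (simp add: finite_rank_projection_def)

lemma proj_proj: "P (P x) = P x"
  using P by (metis comp_apply finite_rank_projection_def)

lemma cinner_proj: "cinner (P x) y = cinner x (P y)"
  using cinner_adjoint_on[OF bounded_op_proj, of x y] P by (simp add: finite_rank_projection_def)

lemma norm_proj_le: "norm (P x) \<le> norm x"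
proof (cases "P x = 0")
  case False
  have "(norm (P x))\<^sup>2 = Re (cinner x (P x))"
    using Re_cinner_self[of "P x"] by (simp add: cinner_proj proj_proj)
  also have "\<dots> \<le> norm x * norm (P x)"
    by (rule Re_cinner_le_norm)
  finally show ?thesis using False by (simp add: power2_eq_square)
qed simp

lemma subspace_range_proj: "complex_vector.subspace (range P)"
proof -
  have "P (x + y) = P x + P y" "P (c *\<^sub>C x) = c *\<^sub>C P x" for x y c
    using bounded_op_proj by (auto simp: bounded_op_on_def)
  then show ?thesis
    unfolding complex_vector.subspace_def
    by (metis (no_types, lifting) complex_vector.scale_zero_left rangeE rangeI)
qed

lemma approx_kernel_compression:
  assumes "bounded_op_on UNIV X" and "X ` range P \<subseteq> range P"
    and "inverse_norm_on (range P) (\<lambda>x. z *\<^sub>C x - X x) \<ge> ereal (1 / \<epsilon>)" "0 < \<epsilon>" "\<epsilon> < \<eta>"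
  shows "\<exists>x. P x = x \<and> norm (z *\<^sub>C x - X x) < \<eta> * norm x"
proof -
  obtain B where B: "finite B" "range P \<subseteq> complex_vector.span B"
    using P by (auto simp: finite_rank_projection_def)
  have "(\<lambda>x. z *\<^sub>C x - X x) ` range P \<subseteq> range P"
    using assms(2)
    by (intro image_subsetI complex_vector.subspace_diff complex_vector.subspace_scale
        subspace_range_proj) auto
  then have "\<exists>x\<in>range P. norm (z *\<^sub>C x - X x) < \<eta> * norm x"
    using bounded_op_on_minus[OF assms(1)] subspace_range_proj B assms(3-)
    by (intro approx_kernel_if_inverse_norm_ge)
  then show ?thesis using proj_proj by auto
qed

context
  fixes T :: "'h \<Rightarrow> 'h"
  assumes T: "bounded_op_on UNIV T"
begin

lemma bounded_linear_commutator: "bounded_linear (commutator P T)"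
  using bounded_linear_compose[of P T] bounded_linear_compose[of T P] bounded_op_proj T
  unfolding commutator_def by (auto simp: bounded_op_on_UNIV_iff intro: bounded_linear_sub)

lemma norm_commutator_le: "norm (P (T x) - T (P x)) \<le> onorm (commutator P T) * norm x"
  using onorm[OF bounded_linear_commutator, of x] by (simp add: commutator_def)

lemma pseudospectrum_compression:
  assumes "0 < \<epsilon>"
  shows "pseudospectrum_on (range P) \<epsilon> (P \<circ> T \<circ> P)
    \<subseteq> pseudospectrum_on UNIV (\<epsilon> + onorm (commutator P T)) T"
proof
  let ?\<delta> = "onorm (commutator P T)"
  fix z assume z: "z \<in> pseudospectrum_on (range P) \<epsilon> (P \<circ> T \<circ> P)"
  have "ereal (1 / (\<epsilon> + ?\<delta>)) \<le> inverse_norm_on UNIV (\<lambda>x. z *\<^sub>C x - T x)"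
  proof (rule inverse_norm_ge_if_approx_kernel)
    show "0 < \<epsilon> + ?\<delta>"
      using assms onorm_pos_le[OF bounded_linear_commutator] by simp
    fix \<eta> assume "\<epsilon> + ?\<delta> < \<eta>"
    then obtain x where x: "P x = x" "norm (z *\<^sub>C x - (P \<circ> T \<circ> P) x) < (\<eta> - ?\<delta>) * norm x"
      using approx_kernel_compression[of "P \<circ> T \<circ> P" \<epsilon> z "\<eta> - ?\<delta>"] z assms
        bounded_op_on_comp[OF bounded_op_on_comp[OF bounded_op_proj T] bounded_op_proj]
      by (force simp: pseudospectrum_on_def)
    \<comment> \<open>Since \<open>P x = x\<close>, the two vectors
      \<open>z *\<^sub>C x - T x\<close> and \<open>z *\<^sub>C x - P (T (P x))\<close> differ by
      the commutator at \<open>x\<close>, which uses up the \<open>?\<delta>\<close> reserved in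
      \<open>\<eta> - ?\<delta>\<close>.\<close>
    have "norm (z *\<^sub>C x - T x) \<le> norm (z *\<^sub>C x - (P \<circ> T \<circ> P) x) + norm (P (T x) - T (P x))"
      using norm_triangle_ineq[of "z *\<^sub>C x - (P \<circ> T \<circ> P) x" "P (T x) - T (P x)"] x(1) by simp
    then show "\<exists>x. norm (z *\<^sub>C x - T x) < \<eta> * norm x"
      using x(2) norm_commutator_le[of x] by (intro exI[of _ x]) (simp add: left_diff_distrib)
  qed
  then show "z \<in> pseudospectrum_on UNIV (\<epsilon> + ?\<delta>) T"
    by (simp add: pseudospectrum_on_def)
qed

text \<open>Relates the adjoint computed inside \<open>range P\<close> to the adjoint on the whole
  space, where the norm estimates are available.\<close>

lemma adjoint_compression:
  assumes "P y = y"
  shows "adjoint_on (range P) (P \<circ> T \<circ> P) y = P (adjoint_on UNIV T y)"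
  unfolding adjoint_on_def[of "range P"]
proof (rule the_equality)
  have *: "cinner ((P \<circ> T \<circ> P) x) y = cinner x (P (adjoint_on UNIV T y))" for x
    using assms by (simp add: cinner_proj cinner_adjoint_on[OF T])
  then show "P (adjoint_on UNIV T y) \<in> range P \<and>
    (\<forall>x\<in>range P. cinner ((P \<circ> T \<circ> P) x) y = cinner x (P (adjoint_on UNIV T y)))" by simp
  fix w assume "w \<in> range P \<and> (\<forall>x\<in>range P. cinner ((P \<circ> T \<circ> P) x) y = cinner x w)"
  then show "w = P (adjoint_on UNIV T y)"
    using * complex_vector.subspace_diff[OF subspace_range_proj] by (intro cinner_ext[of _ "range P"]) auto
qed

text \<open>The commutator of \<open>P\<close> with the adjoint is minus the adjoint of the
  commutator of \<open>P\<close> with \<open>T\<close>. Pairing \<open>?w\<close> with itself moves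
  it to the other side, and one factor \<open>norm ?w\<close> is cancelled.\<close>

lemma norm_commutator_adjoint_le:
  "norm (P (adjoint_on UNIV T x) - adjoint_on UNIV T (P x)) \<le> onorm (commutator P T) * norm x"
    (is "norm ?w \<le> _")
proof (cases "?w = 0")
  case True
  then show ?thesis using onorm_pos_le[OF bounded_linear_commutator] by simp
next
  case False
  have "cinner ?w ?w = cinner (T (P ?w) - P (T ?w)) x"
    by (simp only: cinner_diff_right[of ?w] cinner_diff_left[of _ _ x] cinner_proj[symmetric]
        cinner_adjoint_on[OF T, symmetric])
  then have "(norm ?w)\<^sup>2 \<le> norm (T (P ?w) - P (T ?w)) * norm x"
    using Re_cinner_le_norm by (simp add: Re_cinner_self[symmetric])
  also have "\<dots> \<le> onorm (commutator P T) * norm ?w * norm x"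
    using norm_commutator_le[of ?w] by (intro mult_right_mono) (auto simp: norm_minus_commute)
  finally show ?thesis using False by (simp add: power2_eq_square)
qed

lemma singular_values_compression:
  "subset_upto (sqrt (2 * onorm T * onorm (commutator P T)))
    (singular_values_on (range P) (P \<circ> T \<circ> P)) (singular_values_on UNIV T)"
  unfolding subset_upto_def
proof
  let ?\<delta> = "onorm (commutator P T)" and ?A = "adjoint_on UNIV T"
  fix \<sigma> assume "\<sigma> \<in> singular_values_on (range P) (P \<circ> T \<circ> P)"
  then obtain s where s: "\<sigma> = complex_of_real s" "s \<ge> 0"
    and spec: "(complex_of_real s)\<^sup>2 \<in>
      spectrum_on (range P) (adjoint_on (range P) (P \<circ> T \<circ> P) \<circ> (P \<circ> T \<circ> P))"
    by (auto simp: singular_values_on_def)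
  \<comment> \<open>On \<open>range P\<close> this is the compression followed by its adjoint there,
    but it is composed of operators bounded on the whole space, as
    \<open>approx_kernel_compression\<close> requires.\<close>
  define X where "X = P \<circ> ?A \<circ> P \<circ> T \<circ> P"
  have X: "bounded_op_on UNIV X" "X ` range P \<subseteq> range P"
    unfolding X_def by (intro bounded_op_on_comp bounded_op_proj T bounded_op_adjoint[OF T]) auto
  have "invertible_on (range P)
        (\<lambda>x. (complex_of_real s)\<^sup>2 *\<^sub>C x - (adjoint_on (range P) (P \<circ> T \<circ> P) \<circ> (P \<circ> T \<circ> P)) x)
      \<longleftrightarrow> invertible_on (range P) (\<lambda>x. (complex_of_real s)\<^sup>2 *\<^sub>C x - X x)"
    using adjoint_compression proj_proj by (intro invertible_on_cong) (auto simp: X_def)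
  then have "\<not> invertible_on (range P) (\<lambda>x. (complex_of_real s)\<^sup>2 *\<^sub>C x - X x)"
    using spec by (simp add: spectrum_on_def)
  then have inv: "inverse_norm_on (range P) (\<lambda>x. (complex_of_real s)\<^sup>2 *\<^sub>C x - X x) = \<infinity>"
    by (simp add: inverse_norm_on_def)
  have blT: "bounded_linear T" "bounded_linear ?A"
    using T bounded_op_adjoint[OF T] by (simp_all add: bounded_op_on_UNIV_iff)
  interpret A: bounded_linear ?A by fact
  have "\<exists>\<tau>\<in>singular_values_on UNIV T. cmod (complex_of_real s - \<tau>) \<le> sqrt (2 * onorm T * ?\<delta>)"
  proof (rule singular_value_near[OF T s(2)])
    fix \<eta> assume eta: "2 * onorm T * ?\<delta> < \<eta>"
    define \<epsilon> where "\<epsilon> = \<eta> - 2 * onorm T * ?\<delta>"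
    have "\<epsilon> > 0" using eta by (simp add: \<epsilon>_def)
    \<comment> \<open>The inverse norm is infinite, so every positive tolerance is admissible;
      \<open>\<epsilon> / 2\<close> leaves strict room below \<open>\<epsilon>\<close>.\<close>
    then obtain x where x: "P x = x" "norm ((complex_of_real s)\<^sup>2 *\<^sub>C x - X x) < \<epsilon> * norm x"
      using approx_kernel_compression[OF X, of "\<epsilon> / 2" "(complex_of_real s)\<^sup>2" \<epsilon>] inv by auto
    have "(complex_of_real s)\<^sup>2 *\<^sub>C x = s\<^sup>2 *\<^sub>R x"
      by (simp add: scaleR_scaleC)
    then have x': "norm (X x - s\<^sup>2 *\<^sub>R x) < \<epsilon> * norm x"
      using x(2) by (simp add: norm_minus_commute)
    \<comment> \<open>\<open>?u\<close> keeps the double \<open>P\<close> so that it is the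
      commutator of \<open>P\<close> with \<open>?A\<close> at \<open>P (T x)\<close>;
      \<open>?v\<close> is \<open>?A\<close> applied to the commutator at \<open>x\<close>. Each
      contributes one \<open>onorm T * ?\<delta>\<close>.\<close>
    let ?u = "P (?A (P (T x))) - ?A (P (P (T x)))" and ?v = "?A (P (T x) - T (P x))"
    have "norm ?u \<le> ?\<delta> * norm (P (T x))"
      by (rule norm_commutator_adjoint_le)
    also have "\<dots> \<le> ?\<delta> * (onorm T * norm x)"
      using norm_proj_le[of "T x"] onorm[OF blT(1), of x]
      by (intro mult_left_mono onorm_pos_le bounded_linear_commutator) linarith
    finally have u: "norm ?u \<le> onorm T * ?\<delta> * norm x" by (simp add: mult_ac)
    have "norm ?v \<le> onorm T * norm (P (T x) - T (P x))"
      by (rule norm_adjoint_le[OF T])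
    also have "\<dots> \<le> onorm T * (?\<delta> * norm x)"
      by (intro mult_left_mono norm_commutator_le onorm_pos_le blT)
    finally have v: "norm ?v \<le> onorm T * ?\<delta> * norm x" by (simp add: mult_ac)
    have eq: "?A (T x) - s\<^sup>2 *\<^sub>R x = (X x - s\<^sup>2 *\<^sub>R x) - ?u - ?v"
      by (simp add: X_def x(1) proj_proj A.diff)
    have "norm (?A (T x) - s\<^sup>2 *\<^sub>R x) \<le> norm (X x - s\<^sup>2 *\<^sub>R x) + norm ?u + norm ?v"
      unfolding eq
      using norm_triangle_ineq4[of "X x - s\<^sup>2 *\<^sub>R x" ?u]
        norm_triangle_ineq4[of "X x - s\<^sup>2 *\<^sub>R x - ?u" ?v] by linarith
    also have "\<dots> < \<epsilon> * norm x + onorm T * ?\<delta> * norm x + onorm T * ?\<delta> * norm x"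
      using x' u v by linarith
    also have "\<dots> = \<eta> * norm x" by (simp add: \<epsilon>_def algebra_simps)
    finally show "\<exists>x. norm (?A (T x) - s\<^sup>2 *\<^sub>R x) < \<eta> * norm x" by blast
  qed
  then show "\<exists>\<tau>\<in>singular_values_on UNIV T. cmod (\<sigma> - \<tau>) \<le> sqrt (2 * onorm T * ?\<delta>)"
    using s by simp
qed

end

end

theorem proposition4p5:
  fixes T :: "'h::chilbert_space \<Rightarrow> 'h" and P :: "nat \<Rightarrow> 'h \<Rightarrow> 'h"
  assumes "separable_hilbert TYPE('h)"
    and "bounded_op_on UNIV T"
    and "quasidiagonal T"
    and "filtration P"
    and "(\<lambda>n. onorm (commutator (P n) T)) \<longlonglongrightarrow> 0"
  shows "\<forall>n.
    (\<forall>\<epsilon>>0. pseudospectrum_on (range (P n)) \<epsilon> (P n \<circ> T \<circ> P n)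
             \<subseteq> pseudospectrum_on UNIV (\<epsilon> + onorm (commutator (P n) T)) T) \<and>
    subset_upto (sqrt (2 * onorm T * onorm (commutator (P n) T)))
      (singular_values_on (range (P n)) (P n \<circ> T \<circ> P n))
      (singular_values_on UNIV T)"
proof (intro allI conjI impI)
  fix n
  have P: "finite_rank_projection (P n)"
    using assms(4) by (simp add: filtration_def)
  show "pseudospectrum_on (range (P n)) \<epsilon> (P n \<circ> T \<circ> P n)
      \<subseteq> pseudospectrum_on UNIV (\<epsilon> + onorm (commutator (P n) T)) T" if "\<epsilon> > 0" for \<epsilon>
    using pseudospectrum_compression[OF P assms(2) that] .
  show "subset_upto (sqrt (2 * onorm T * onorm (commutator (P n) T)))
      (singular_values_on (range (P n)) (P n \<circ> T \<circ> P n)) (singular_values_on UNIV T)"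
    using singular_values_compression[OF P assms(2)] .
qed

end
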